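(* Let $\mathfrak g$ be a simple Lie algebra over $\mathbb C$ and let $\{e,h,f\}\subset\mathfrak g$ be an $sl_2$-triple. Then the transverse Poisson structure to the adjoint orbit of the nilpotent element $e$, i.e. the Dirac reduction to the Slodowy slice $\widetilde Q=e+\mathfrak g_f$, $\mathfrak g_f=\ker\mathrm{ad}\,f$, of the Lie-Poisson bracket on $\mathfrak g$ (identified with $\mathfrak g^*$ by the Killing form), is polynomial: the brackets of linear coordinates on $\widetilde Q$ are polynomial functions on $\widetilde Q$.
   Context: $[h,e]=2e$, $[h,f]=-2f$, $[e,f]=h$. Let $\langle\cdot|\cdot\rangle$ be the Killing form, $\xi_1,\dots,\xi_n$ a basis of $\mathfrak g$ with $\xi_1,\dots,\xi_m$ a basis of $\mathfrak g_f$, $\xi^i$ the dual basis, and $q^i(z)=\langle z-e|\xi^i\rangle$ affine coordinates on $\mathfrak g$, so that $\widetilde Q$ is defined by $q^\alpha=0$, $\alpha=m+1,\dots,n$, and $q^1,\dots,q^m$ are coordinates on $\widetilde Q$. The Lie-Poisson bracket (up to an overall sign convention) is $\{q^i,q^j\}(z)=F^{ij}(z)=-\langle z|[\xi^i,\xi^j]\rangle$. The Dirac reduction to $\widetilde Q$ is the bracket $\{q^i,q^j\}^{\widetilde Q}=F^{ij}-F^{i\beta}F_{\beta\alpha}F^{\alpha j}$ ($i,j\le m$, sum over $\alpha,\beta>m$), where $(F_{\alpha\beta})$ is the inverse of the minor matrix $(F^{\alpha\beta})_{\alpha,\beta>m}$ on $\widetilde Q$. *)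

theory Defs
  imports Complex_Main
begin

definition (in vector_space) basis_family :: "'b set \<Rightarrow> 'i set \<Rightarrow> ('i \<Rightarrow> 'b) \<Rightarrow> bool" where
  "basis_family V I \<xi> \<longleftrightarrow> inj_on \<xi> I \<and> independent (\<xi> ` I) \<and> span (\<xi> ` I) = V"

(* The trace of an endomorphism of a finite-dimensional space; it does not depend on the
   chosen basis.  representation B v b is the coefficient of b in the expansion of v. *)
definition (in vector_space) endo_trace :: "('b \<Rightarrow> 'b) \<Rightarrow> 'a" where
  "endo_trace T =
    (let B = (SOME B. independent B \<and> span B = UNIV) in \<Sum>b\<in>B. representation B (T b) b)"

locale lie_algebra = vector_space scale
  for scale :: "'k::field \<Rightarrow> 'g::ab_group_add \<Rightarrow> 'g" +
  fixes br :: "'g \<Rightarrow> 'g \<Rightarrow> 'g"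
  assumes br_add_left: "br (x + y) z = br x z + br y z"
    and br_add_right: "br x (y + z) = br x y + br x z"
    and br_scale_left: "br (scale c x) y = scale c (br x y)"
    and br_scale_right: "br x (scale c y) = scale c (br x y)"
    and br_self: "br x x = 0"
    and jacobi: "br x (br y z) + br y (br z x) + br z (br x y) = 0"

definition (in lie_algebra) lie_ideal :: "'g set \<Rightarrow> bool" where
  "lie_ideal I \<longleftrightarrow> subspace I \<and> (\<forall>x. \<forall>y\<in>I. br x y \<in> I)"

locale simple_lie_algebra = lie_algebra +
  assumes finite_dim: "\<exists>B. finite B \<and> span B = UNIV"
    and nonabelian: "\<exists>x y. br x y \<noteq> 0"
    and no_proper_ideals: "lie_ideal I \<Longrightarrow> I = {0} \<or> I = UNIV"

definition (in lie_algebra) sl2_triple :: "'g \<Rightarrow> 'g \<Rightarrow> 'g \<Rightarrow> bool" where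
  "sl2_triple e h f \<longleftrightarrow> br h e = scale 2 e \<and> br h f = scale (- 2) f \<and> br e f = h"

definition (in lie_algebra) killing :: "'g \<Rightarrow> 'g \<Rightarrow> 'k" where
  "killing x y = endo_trace (\<lambda>v. br x (br y v))"

definition (in lie_algebra) dual_family :: "'i set \<Rightarrow> ('i \<Rightarrow> 'g) \<Rightarrow> ('i \<Rightarrow> 'g) \<Rightarrow> bool" where
  "dual_family I \<xi> \<eta> \<longleftrightarrow> (\<forall>i\<in>I. \<forall>j\<in>I. killing (\<xi> i) (\<eta> j) = (if i = j then 1 else 0))"

definition (in lie_algebra) ad_kernel :: "'g \<Rightarrow> 'g set" where
  "ad_kernel f = {x. br f x = 0}"

definition (in lie_algebra) slodowy_slice :: "'g \<Rightarrow> 'g \<Rightarrow> 'g set" where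
  "slodowy_slice e f = {e + x | x. x \<in> ad_kernel f}"

(* In what follows \<eta> is the dual basis, i.e. \<eta> i is the basis vector with upper index i. *)
definition (in lie_algebra) coord :: "'g \<Rightarrow> ('i \<Rightarrow> 'g) \<Rightarrow> 'i \<Rightarrow> 'g \<Rightarrow> 'k" where
  "coord e \<eta> i z = killing (z - e) (\<eta> i)"

(* The Lie-Poisson bracket of the coordinate functions i and j at the point z. *)
definition (in lie_algebra) lie_poisson :: "('i \<Rightarrow> 'g) \<Rightarrow> 'i \<Rightarrow> 'i \<Rightarrow> 'g \<Rightarrow> 'k" where
  "lie_poisson \<eta> i j z = - killing z (br (\<eta> i) (\<eta> j))"

definition matrix_inverse_on ::
    "'i set \<Rightarrow> ('i \<Rightarrow> 'i \<Rightarrow> 'k::field) \<Rightarrow> ('i \<Rightarrow> 'i \<Rightarrow> 'k) \<Rightarrow> bool" where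
  "matrix_inverse_on A M N \<longleftrightarrow>
    (\<forall>\<alpha>\<in>A. \<forall>\<beta>\<in>A. (\<Sum>\<gamma>\<in>A. M \<alpha> \<gamma> * N \<gamma> \<beta>) = (if \<alpha> = \<beta> then 1 else 0) \<and>
                 (\<Sum>\<gamma>\<in>A. N \<alpha> \<gamma> * M \<gamma> \<beta>) = (if \<alpha> = \<beta> then 1 else 0))"

(* The lower-index matrix: the inverse of the A-minor of the Poisson matrix at z.  The choice
   fixes its entries on A whenever the minor is invertible; the entries off A are never used. *)
definition (in lie_algebra) minor_inverse ::
    "('i \<Rightarrow> 'g) \<Rightarrow> 'i set \<Rightarrow> 'g \<Rightarrow> 'i \<Rightarrow> 'i \<Rightarrow> 'k" where
  "minor_inverse \<eta> A z = (SOME N. matrix_inverse_on A (\<lambda>\<alpha> \<beta>. lie_poisson \<eta> \<alpha> \<beta> z) N)"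

(* Dirac reduction with respect to the constraints coord e \<eta> \<alpha> = 0 for \<alpha> in A. *)
definition (in lie_algebra) dirac_bracket ::
    "('i \<Rightarrow> 'g) \<Rightarrow> 'i set \<Rightarrow> 'i \<Rightarrow> 'i \<Rightarrow> 'g \<Rightarrow> 'k" where
  "dirac_bracket \<eta> A i j z = lie_poisson \<eta> i j z -
    (\<Sum>\<alpha>\<in>A. \<Sum>\<beta>\<in>A. lie_poisson \<eta> i \<beta> z * minor_inverse \<eta> A z \<beta> \<alpha> * lie_poisson \<eta> \<alpha> j z)"

(* On Q, the function g is a polynomial in the coordinate functions q i with i in I;
   k ranges over a finite set S of exponent vectors and c k is the coefficient. *)
definition polynomial_function_on ::
    "'p set \<Rightarrow> 'i set \<Rightarrow> ('i \<Rightarrow> 'p \<Rightarrow> 'k::field) \<Rightarrow> ('p \<Rightarrow> 'k) \<Rightarrow> bool" where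
  "polynomial_function_on Q I q g \<longleftrightarrow>
    (\<exists>(S :: ('i \<Rightarrow> nat) set) c. finite S \<and>
      (\<forall>z\<in>Q. g z = (\<Sum>k\<in>S. c k * (\<Prod>i\<in>I. q i z ^ k i))))"

end

theory Submission
  imports Defs "HOL-Computational_Algebra.Polynomial"
begin

text \<open>The vectors \<open>\<eta> \<alpha>\<close>, \<open>\<alpha> > m\<close>, span the image of \<open>ad f\<close>, whose orthogonal complement is
  \<open>ker (ad f)\<close>.  Hence column \<open>\<beta>\<close> of the inverse minor at \<open>z = e + x\<close> is the solution \<open>u\<close> in the
  image of \<open>ad f\<close> of \<open>[f, [z, u]] = [f, \<xi> \<beta>]\<close>.  By \<open>sl\<^sub>2\<close> theory \<open>ad f ad e\<close> is bijective on this
  image, and its inverse preserves the kernels of the powers of the nilpotent operator \<open>ad f\<close>,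
  whereas \<open>ad f ad x = ad x ad f\<close> lowers the exponent by one.  So the iteration solving the
  equation as a perturbation of \<open>x = 0\<close> stops after finitely many steps, and its result is
  polynomial in \<open>x\<close>.\<close>

section \<open>Polynomial functions\<close>

text \<open>The definition allows each exponent vector only once. Here the monomials carry an
  arbitrary finite index and those with equal exponents are merged by adding coefficients. Closure
  under sums and products then needs only the index sets \<open>S <+> T\<close> and
  \<open>S \<times> T\<close>.\<close>

lemma polynomial_function_onI:
  assumes "finite J" and g: "\<And>z. z \<in> Q \<Longrightarrow> g z = (\<Sum>j\<in>J. c j * (\<Prod>i\<in>I. q i z ^ k j i))"
  shows "polynomial_function_on Q I q g"
  unfolding polynomial_function_on_def
proof (intro exI conjI ballI)
  show "finite (k ` J)" using assms by simp
  fix z assume "z \<in> Q"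
  have "g z = (\<Sum>s\<in>k ` J. \<Sum>j\<in>{j\<in>J. k j = s}. c j * (\<Prod>i\<in>I. q i z ^ k j i))"
    unfolding g[OF \<open>z \<in> Q\<close>] by (rule sum.image_gen[OF \<open>finite J\<close>])
  also have "\<dots> = (\<Sum>s\<in>k ` J. (\<Sum>j\<in>{j\<in>J. k j = s}. c j) * (\<Prod>i\<in>I. q i z ^ s i))"
    by (intro sum.cong refl) (simp add: sum_distrib_right)
  finally show "g z = (\<Sum>s\<in>k ` J. (\<Sum>j\<in>{j\<in>J. k j = s}. c j) * (\<Prod>i\<in>I. q i z ^ s i))" .
qed

lemma polynomial_function_on_cong:
  assumes "polynomial_function_on Q I q g" "\<And>z. z \<in> Q \<Longrightarrow> g' z = g z"
  shows "polynomial_function_on Q I q g'"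
  using assms unfolding polynomial_function_on_def by simp

lemma polynomial_function_on_const: "polynomial_function_on Q I q (\<lambda>z. a)"
  by (rule polynomial_function_onI[where J = "{()}" and c = "\<lambda>_. a" and k = "\<lambda>_ _. 0"]) auto

lemma polynomial_function_on_coord:
  assumes "finite I" "i \<in> I"
  shows "polynomial_function_on Q I q (q i)"
proof (rule polynomial_function_onI[where J = "{()}" and c = "\<lambda>_. 1" and k = "\<lambda>_ j. if j = i then 1 else 0"])
  fix z
  have "(\<Prod>j\<in>I. q j z ^ (if j = i then 1 else 0)) = (\<Prod>j\<in>I. if j = i then q j z else 1)"
    by (rule prod.cong) auto
  then show "q i z = (\<Sum>_\<in>{()}. 1 * (\<Prod>j\<in>I. q j z ^ (if j = i then 1 else 0)))"
    using assms by simp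
qed simp

lemma polynomial_function_on_add:
  assumes "polynomial_function_on Q I q g1" "polynomial_function_on Q I q g2"
  shows "polynomial_function_on Q I q (\<lambda>z. g1 z + g2 z)"
proof -
  obtain S c where S: "finite S" "\<And>z. z \<in> Q \<Longrightarrow> g1 z = (\<Sum>k\<in>S. c k * (\<Prod>i\<in>I. q i z ^ k i))"
    using assms(1) unfolding polynomial_function_on_def by blast
  obtain T d where T: "finite T" "\<And>z. z \<in> Q \<Longrightarrow> g2 z = (\<Sum>k\<in>T. d k * (\<Prod>i\<in>I. q i z ^ k i))"
    using assms(2) unfolding polynomial_function_on_def by blast
  show ?thesis
    by (rule polynomial_function_onI[where J = "S <+> T" and c = "case_sum c d" and k = "case_sum id id"])
      (simp_all add: S T sum.Plus)
qed

lemma polynomial_function_on_mult: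
  assumes "polynomial_function_on Q I q g1" "polynomial_function_on Q I q g2"
  shows "polynomial_function_on Q I q (\<lambda>z. g1 z * g2 z)"
proof -
  obtain S c where S: "finite S" "\<And>z. z \<in> Q \<Longrightarrow> g1 z = (\<Sum>k\<in>S. c k * (\<Prod>i\<in>I. q i z ^ k i))"
    using assms(1) unfolding polynomial_function_on_def by blast
  obtain T d where T: "finite T" "\<And>z. z \<in> Q \<Longrightarrow> g2 z = (\<Sum>k\<in>T. d k * (\<Prod>i\<in>I. q i z ^ k i))"
    using assms(2) unfolding polynomial_function_on_def by blast
  show ?thesis
  proof (rule polynomial_function_onI[where J = "S \<times> T" and c = "\<lambda>(k, l). c k * d l" and k = "\<lambda>(k, l) i. k i + l i"])
    show "finite (S \<times> T)" using S T by simp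
    fix z assume z: "z \<in> Q"
    show "g1 z * g2 z = (\<Sum>j\<in>S \<times> T. (case j of (k, l) \<Rightarrow> c k * d l)
        * (\<Prod>i\<in>I. q i z ^ (case j of (k, l) \<Rightarrow> \<lambda>i. k i + l i) i))"
      unfolding S(2)[OF z] T(2)[OF z] sum_product sum.cartesian_product
      by (rule sum.cong) (auto simp: power_add prod.distrib mult_ac)
  qed
qed

lemma polynomial_function_on_uminus:
  assumes "polynomial_function_on Q I q g"
  shows "polynomial_function_on Q I q (\<lambda>z. - g z)"
  using polynomial_function_on_mult[OF polynomial_function_on_const[of _ _ _ "-1"] assms] by simp

lemma polynomial_function_on_diff:
  assumes "polynomial_function_on Q I q g1" "polynomial_function_on Q I q g2"
  shows "polynomial_function_on Q I q (\<lambda>z. g1 z - g2 z)"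
  using polynomial_function_on_add[OF assms(1) polynomial_function_on_uminus[OF assms(2)]] by simp

lemma polynomial_function_on_sum:
  assumes "\<And>j. j \<in> J \<Longrightarrow> polynomial_function_on Q I q (g j)"
  shows "polynomial_function_on Q I q (\<lambda>z. \<Sum>j\<in>J. g j z)"
  using assms
  by (induction J rule: infinite_finite_induct)
    (auto intro: polynomial_function_on_const polynomial_function_on_add)

lemmas polynomial_function_on_intros =
  polynomial_function_on_const polynomial_function_on_coord polynomial_function_on_add
  polynomial_function_on_mult polynomial_function_on_uminus polynomial_function_on_diff
  polynomial_function_on_sum

section \<open>Inverse matrices\<close>

text \<open>\<open>N = N (M N') = (N M) N' = N'\<close>. This is what determines on \<open>A\<close>
  the matrix that \<open>minor_inverse\<close> selects by \<open>SOME\<close>.\<close>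

lemma matrix_inverse_on_unique:
  assumes "finite A" "matrix_inverse_on A M N" "matrix_inverse_on A M N'" "\<alpha> \<in> A" "\<beta> \<in> A"
  shows "N \<alpha> \<beta> = N' \<alpha> \<beta>"
proof -
  have "N \<alpha> \<beta> = (\<Sum>\<gamma>\<in>A. N \<alpha> \<gamma> * (if \<gamma> = \<beta> then 1 else 0))"
    using assms by (simp add: if_distrib cong: if_cong)
  also have "\<dots> = (\<Sum>\<gamma>\<in>A. N \<alpha> \<gamma> * (\<Sum>\<delta>\<in>A. M \<gamma> \<delta> * N' \<delta> \<beta>))"
    using assms(3,5) by (intro sum.cong refl) (simp add: matrix_inverse_on_def)
  also have "\<dots> = (\<Sum>\<delta>\<in>A. (\<Sum>\<gamma>\<in>A. N \<alpha> \<gamma> * M \<gamma> \<delta>) * N' \<delta> \<beta>)"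
    unfolding sum_distrib_left sum_distrib_right by (subst sum.swap) (simp add: mult_ac)
  also have "\<dots> = (\<Sum>\<delta>\<in>A. (if \<alpha> = \<delta> then 1 else 0) * N' \<delta> \<beta>)"
    using assms(2,4) by (intro sum.cong refl) (simp add: matrix_inverse_on_def)
  also have "\<dots> = N' \<alpha> \<beta>"
    using assms by (simp add: if_distrib[of "\<lambda>x. x * _"] cong: if_cong)
  finally show ?thesis .
qed

text \<open>Transposing \<open>M N = 1\<close> for a skew \<open>M\<close> shows that the negative
  transpose of \<open>N\<close> is a left inverse. As a left and a right inverse agree, it equals
  \<open>N\<close>, so \<open>N\<close> is two-sided without any rank argument.\<close>

lemma matrix_inverse_on_skew:
  fixes M :: "'i \<Rightarrow> 'i \<Rightarrow> 'k::field"
  assumes "finite A"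
    and skew: "\<And>\<alpha> \<beta>. \<alpha> \<in> A \<Longrightarrow> \<beta> \<in> A \<Longrightarrow> M \<beta> \<alpha> = - M \<alpha> \<beta>"
    and right: "\<And>\<alpha> \<beta>. \<alpha> \<in> A \<Longrightarrow> \<beta> \<in> A \<Longrightarrow> (\<Sum>\<gamma>\<in>A. M \<alpha> \<gamma> * N \<gamma> \<beta>) = (if \<alpha> = \<beta> then 1 else 0)"
  shows "matrix_inverse_on A M N"
proof -
  have left: "(\<Sum>\<gamma>\<in>A. - N \<gamma> \<alpha> * M \<gamma> \<beta>) = (if \<alpha> = \<beta> then 1 else 0)" if "\<alpha> \<in> A" "\<beta> \<in> A" for \<alpha> \<beta>
  proof -
    have "(\<Sum>\<gamma>\<in>A. - N \<gamma> \<alpha> * M \<gamma> \<beta>) = (\<Sum>\<gamma>\<in>A. M \<beta> \<gamma> * N \<gamma> \<alpha>)"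
      using that by (intro sum.cong refl) (simp add: skew[of \<beta>])
    then show ?thesis using right[OF that(2,1)] by auto
  qed
  have "- N \<beta> \<alpha> = N \<alpha> \<beta>" if "\<alpha> \<in> A" "\<beta> \<in> A" for \<alpha> \<beta>
  proof -
    have "- N \<beta> \<alpha> = (\<Sum>\<gamma>\<in>A. - N \<gamma> \<alpha> * (if \<gamma> = \<beta> then 1 else 0))"
      using assms(1) that by (simp add: if_distrib cong: if_cong)
    also have "\<dots> = (\<Sum>\<gamma>\<in>A. - N \<gamma> \<alpha> * (\<Sum>\<delta>\<in>A. M \<gamma> \<delta> * N \<delta> \<beta>))"
      using that by (intro sum.cong refl) (simp add: right)
    also have "\<dots> = (\<Sum>\<delta>\<in>A. (\<Sum>\<gamma>\<in>A. - N \<gamma> \<alpha> * M \<gamma> \<delta>) * N \<delta> \<beta>)"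
      unfolding sum_distrib_left sum_distrib_right by (subst sum.swap) (simp add: mult_ac)
    also have "\<dots> = (\<Sum>\<delta>\<in>A. (if \<alpha> = \<delta> then 1 else 0) * N \<delta> \<beta>)"
      using that by (intro sum.cong refl) (simp only: left)
    also have "\<dots> = N \<alpha> \<beta>"
      using assms(1) that by (simp add: if_distrib[of "\<lambda>x. x * _"] cong: if_cong)
    finally show ?thesis .
  qed
  then have "(\<Sum>\<gamma>\<in>A. N \<alpha> \<gamma> * M \<gamma> \<beta>) = (if \<alpha> = \<beta> then 1 else 0)" if "\<alpha> \<in> A" "\<beta> \<in> A" for \<alpha> \<beta>
    unfolding left[OF that, symmetric] using that by (intro sum.cong refl) simp
  with right show ?thesis unfolding matrix_inverse_on_def by simp
qed

section \<open>Polynomials in a linear operator\<close>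

locale linear_operator = vector_space scale
  for scale :: "'k::field \<Rightarrow> 'v::ab_group_add \<Rightarrow> 'v" +
  fixes T :: "'v \<Rightarrow> 'v"
  assumes linear_T: "module_hom scale scale T"
begin

sublocale T: module_hom scale scale T by (rule linear_T)

lemma funpow_linear: "module_hom scale scale (T ^^ k)"
proof (induction k)
  case 0
  show ?case by unfold_locales auto
next
  case (Suc k)
  then interpret k: module_hom scale scale "T ^^ k" .
  show ?case by unfold_locales (auto simp: k.add k.scale T.add T.scale)
qed

sublocale Tk: module_hom scale scale "T ^^ k" for k by (rule funpow_linear)

lemma funpow_eq_0_mono: "(T ^^ k) v = 0 \<Longrightarrow> k \<le> l \<Longrightarrow> (T ^^ l) v = 0"
  by (metis Tk.zero comp_apply funpow_add le_add_diff_inverse2)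

definition poly_op :: "'k poly \<Rightarrow> 'v \<Rightarrow> 'v" where
  "poly_op p v = (\<Sum>i\<le>degree p. scale (coeff p i) ((T ^^ i) v))"

lemma poly_op_eq:
  assumes "degree p \<le> d"
  shows "poly_op p v = (\<Sum>i\<le>d. scale (coeff p i) ((T ^^ i) v))"
  unfolding poly_op_def using assms by (intro sum.mono_neutral_left) (auto simp: coeff_eq_0)

lemma poly_op_0 [simp]: "poly_op 0 v = 0"
  by (simp add: poly_op_def)

lemma poly_op_1 [simp]: "poly_op 1 v = v"
  by (simp add: poly_op_def)

lemma poly_op_add: "poly_op (p + q) v = poly_op p v + poly_op q v"
  by (simp add: poly_op_eq[of _ "max (degree p) (degree q)"] degree_add_le_max
      scale_left_distrib sum.distrib)

lemma poly_op_smult: "poly_op (smult a p) v = scale a (poly_op p v)"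
  by (simp add: poly_op_eq[of _ "degree p"] scale_sum_right)

lemma poly_op_diff: "poly_op (p - q) v = poly_op p v - poly_op q v"
  by (simp add: poly_op_eq[of _ "max (degree p) (degree q)"] degree_diff_le_max
      scale_left_diff_distrib sum_subtractf)

lemma poly_op_pCons: "poly_op (pCons a p) v = scale a v + T (poly_op p v)"
proof -
  have "poly_op (pCons a p) v = (\<Sum>i\<le>Suc (degree p). scale (coeff (pCons a p) i) ((T ^^ i) v))"
    by (rule poly_op_eq) (rule degree_pCons_le)
  also have "\<dots> = scale a v + T (poly_op p v)"
    by (simp add: sum.atMost_Suc_shift poly_op_def T.sum T.scale del: sum.atMost_Suc)
  finally show ?thesis .
qed

lemma poly_op_linear: "module_hom scale scale (poly_op p)"
  by unfold_locales
    (auto simp: poly_op_def Tk.add Tk.scale scale_right_distrib sum.distrib scale_sum_right mult.commute)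

lemma poly_op_mult: "poly_op (p * q) v = poly_op p (poly_op q v)"
  by (induction p) (simp_all add: poly_op_add poly_op_smult poly_op_pCons)

text \<open>The \<open>card B + 1\<close> iterates of \<open>v\<close> are too many to be
  independent, and the coefficients of a linear relation are those of \<open>p\<close>. Since
  dependence is a property of sets, coinciding iterates are a separate case, settled by a difference
  of two monomials.\<close>

lemma ex_annihilating_poly_vector:
  assumes B: "finite B" "span B = UNIV"
  shows "\<exists>p. p \<noteq> 0 \<and> poly_op p v = 0"
proof (cases "inj_on (\<lambda>i. (T ^^ i) v) {..card B}")
  case True
  let ?g = "\<lambda>i. (T ^^ i) v"
  have "dependent (?g ` {..card B})"
    using independent_span_bound[OF B(1), of "?g ` {..card B}"] B(2) card_image[OF True] by auto
  then obtain u w where w: "w \<in> ?g ` {..card B}" "u w \<noteq> 0"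
    and u: "(\<Sum>w\<in>?g ` {..card B}. scale (u w) w) = 0"
    by (subst (asm) dependent_finite) auto
  define p where "p = Poly (map (\<lambda>i. u (?g i)) [0..<Suc (card B)])"
  have coeff_p: "coeff p i = (if i \<le> card B then u (?g i) else 0)" for i
    unfolding p_def coeff_Poly_eq nth_default_def by (auto simp del: upt_Suc)
  obtain j where j: "j \<le> card B" "w = ?g j" using w by auto
  have "p \<noteq> 0" using coeff_p[of j] j w(2) by auto
  moreover have "degree p \<le> card B" by (rule degree_le) (simp add: coeff_p)
  then have "poly_op p v = (\<Sum>i\<le>card B. scale (u (?g i)) (?g i))"
    by (subst poly_op_eq, assumption) (simp add: coeff_p)
  then have "poly_op p v = 0"
    using u by (simp add: sum.reindex[OF True] o_def)
  ultimately show ?thesis by blast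
next
  case False
  then obtain i j where ij: "i \<noteq> j" "(T ^^ i) v = (T ^^ j) v" by (auto simp: inj_on_def)
  have mon: "poly_op (monom 1 i) v = (T ^^ i) v" for i
    by (induction i) (simp_all add: poly_op_pCons monom_Suc monom_0 flip: one_pCons)
  show ?thesis
    by (rule exI[of _ "monom 1 i - monom 1 j"])
      (use ij in \<open>auto simp: poly_op_diff mon monom_eq_iff'\<close>)
qed

text \<open>Polynomials in \<open>T\<close> commute, so a product of annihilators of finitely many
  vectors annihilates all of them. Taking a finite spanning set then gives the zero
  operator.\<close>

lemma ex_annihilating_poly:
  assumes B: "finite B" "span B = UNIV"
  shows "\<exists>p. p \<noteq> 0 \<and> (\<forall>v. poly_op p v = 0)"
proof -
  have "\<exists>p. p \<noteq> 0 \<and> (\<forall>v\<in>S. poly_op p v = 0)" if "finite S" for S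
    using that
  proof (induction S)
    case empty
    show ?case by (rule exI[of _ 1]) auto
  next
    case (insert a S)
    then obtain p where p: "p \<noteq> 0" "\<forall>v\<in>S. poly_op p v = 0" by blast
    obtain q where q: "q \<noteq> 0" "poly_op q a = 0" using ex_annihilating_poly_vector[OF B] by blast
    interpret p: module_hom scale scale "poly_op p" by (rule poly_op_linear)
    interpret q: module_hom scale scale "poly_op q" by (rule poly_op_linear)
    have "poly_op (p * q) v = 0" if "v \<in> insert a S" for v
    proof (cases "v = a")
      case True
      then show ?thesis by (simp add: poly_op_mult q(2) p.zero)
    next
      case False
      then have "poly_op (q * p) v = 0" using that p(2) by (simp add: poly_op_mult q.zero)
      then show ?thesis by (simp add: mult.commute)
    qed
    then show ?case using p(1) q(1) by (intro exI[of _ "p * q"]) auto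
  qed
  then obtain p where p: "p \<noteq> 0" "\<forall>v\<in>B. poly_op p v = 0" using B(1) by blast
  interpret p: module_hom scale scale "poly_op p" by (rule poly_op_linear)
  have "poly_op p v = 0" for v
    using p.eq_0_on_span[of B v] p(2) B(2) by auto
  then show ?thesis using p(1) by blast
qed

end

text \<open>Applying the derivation \<open>[H, -]\<close> to a relation \<open>p(F) = 0\<close> gives \<open>F p'(F) = 0\<close>; for \<open>p\<close> of
  minimal degree this forces \<open>p\<close> to be a monomial.\<close>

lemma (in linear_operator) nilpotent_if_commutator:
  assumes char: "\<And>n. n > 0 \<Longrightarrow> (of_nat n :: 'k) \<noteq> 0"
    and B: "finite B" "span B = UNIV"
    and H: "module_hom scale scale H"
    and HT: "\<And>v. H (T v) = T (H v) + scale c (T v)" and c: "c \<noteq> 0"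
  shows "\<exists>N. \<forall>v. (T ^^ N) v = 0"
proof -
  interpret H: module_hom scale scale H by (rule H)
  have HTk: "H ((T ^^ k) v) = (T ^^ k) (H v) + scale (of_nat k * c) ((T ^^ k) v)" for k v
    by (induction k) (simp_all add: HT T.add T.scale distrib_right scale_left_distrib)
  define P where "P d \<longleftrightarrow> (\<exists>p. p \<noteq> 0 \<and> degree p = d \<and> (\<forall>v. poly_op p v = 0))" for d
  define d where "d = (LEAST d. P d)"
  have "\<exists>d. P d" using ex_annihilating_poly[OF B] by (auto simp: P_def)
  then have "P d" unfolding d_def by (rule LeastI_ex)
  then obtain p where p: "p \<noteq> 0" "degree p = d" "\<And>v. poly_op p v = 0" by (auto simp: P_def)
  have least: "\<not> P i" if "i < d" for i using not_less_Least that d_def by metis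
  \<comment> \<open>This is \<open>X p'(X)\<close>: its coefficients contain the factor
    \<open>i\<close> that appears, times \<open>c\<close>, when \<open>H\<close> is commuted past
    \<open>T ^^ i\<close>.\<close>
  define q where "q = pCons 0 (pderiv p)"
  have coeff_q: "coeff q i = of_nat i * coeff p i" for i
    by (cases i) (simp_all add: q_def coeff_pderiv)
  have deg_q: "degree q \<le> d" by (rule degree_le) (simp add: coeff_q coeff_eq_0 p(2))
  have q0: "poly_op q v = 0" for v
  proof -
    have "0 = H (poly_op p v) - poly_op p (H v)" by (simp add: p)
    also have "\<dots> = (\<Sum>i\<le>d. scale (coeff p i) (scale (of_nat i * c) ((T ^^ i) v)))"
      unfolding poly_op_def H.sum sum_subtractf[symmetric] p(2)
      by (intro sum.cong refl) (simp only: H.scale HTk scale_right_distrib add_diff_cancel_left')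
    also have "\<dots> = scale c (poly_op q v)"
      unfolding poly_op_eq[OF deg_q] scale_sum_right by (intro sum.cong refl) (simp add: coeff_q mult_ac)
    finally show ?thesis using c by simp
  qed
  \<comment> \<open>The terms of degree \<open>d\<close> cancel, so \<open>r\<close> annihilates
    everything and, if nonzero, has degree below \<open>d\<close>. Minimality forces
    \<open>r = 0\<close>, that is, \<open>(d - i) * coeff p i = 0\<close> for all
    \<open>i\<close>.\<close>
  define r where "r = smult (of_nat d) p - q"
  have coeff_r: "coeff r i = (of_nat d - of_nat i) * coeff p i" for i
    by (simp add: r_def coeff_q left_diff_distrib)
  have r0: "poly_op r v = 0" for v by (simp add: r_def poly_op_diff poly_op_smult p q0)
  have "r = 0"
  proof (rule ccontr)
    assume "r \<noteq> 0"
    moreover have "degree r \<le> d" by (rule degree_le) (simp add: coeff_r coeff_eq_0 p(2))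
    moreover have "coeff r d = 0" by (simp add: coeff_r)
    ultimately have "degree r < d" by (metis leading_coeff_0_iff nat_less_le)
    then show False using least[of "degree r"] \<open>r \<noteq> 0\<close> r0 by (auto simp: P_def)
  qed
  have "coeff p i = 0" if "i < d" for i
  proof -
    have "of_nat d - of_nat i = (of_nat (d - i) :: 'k)" using that by (simp add: of_nat_diff)
    then show ?thesis using coeff_r[of i] \<open>r = 0\<close> char[of "d - i"] that by auto
  qed
  then have "poly_op p v = scale (coeff p d) ((T ^^ d) v)" for v
    unfolding poly_op_def p(2) by (subst sum.remove[of _ d]) auto
  then have "(T ^^ d) v = 0" for v using p by (metis leading_coeff_0_iff scale_eq_0_iff)
  then show ?thesis by blast
qed

section \<open>Representations of \<open>sl\<^sub>2\<close>\<close>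

locale sl2_representation = vector_space scale
  for scale :: "'k::field_char_0 \<Rightarrow> 'v::ab_group_add \<Rightarrow> 'v" +
  fixes E H F :: "'v \<Rightarrow> 'v"
  assumes linear_E: "module_hom scale scale E" and linear_H: "module_hom scale scale H"
    and linear_F: "module_hom scale scale F"
    and HF: "H (F v) = F (H v) - scale 2 (F v)"
    and EF: "E (F v) = F (E v) + H v"
begin

sublocale E: module_hom scale scale E by (rule linear_E)
sublocale H: module_hom scale scale H by (rule linear_H)
sublocale F: linear_operator scale F by (intro linear_operator.intro linear_operator_axioms.intro vector_space_axioms linear_F)

text \<open>This is the commutator of \<open>E\<close> with a power of \<open>F\<close>: by
  induction, each further \<open>F\<close> produces one \<open>H\<close> when it passes
  \<open>E\<close> and a shift by 2 when it passes \<open>H\<close>. With \<open>H\<close> to the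
  left of \<open>F ^^ k\<close>, the formula can be read off at \<open>u = (F ^^ k) v\<close>; if
  \<open>F u = 0\<close>, only a multiple of \<open>H u + k u\<close> remains.\<close>

lemma funpow_F_E:
  "(F ^^ Suc k) (E v) = E ((F ^^ Suc k) v)
    - scale (of_nat (Suc k)) (H ((F ^^ k) v) + scale (of_nat k) ((F ^^ k) v))"
proof (induction k)
  case 0
  show ?case by (simp add: EF)
next
  case (Suc k)
  define u where "u = (F ^^ k) v"
  have "(F ^^ Suc (Suc k)) (E v) = F (E (F u) - scale (of_nat (Suc k)) (H u + scale (of_nat k) u))"
    using Suc unfolding u_def by simp
  also have "\<dots> = E (F (F u)) - H (F u)
      - scale (of_nat (Suc k)) (H (F u) + scale 2 (F u) + scale (of_nat k) (F u))"
    by (simp add: F.T.diff F.T.scale F.T.add EF[of "F u"] HF[of u])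
  also have "\<dots> = E (F (F u)) - scale (of_nat (Suc (Suc k))) (H (F u) + scale (of_nat (Suc k)) (F u))"
    using scale_left_distrib[of 1 1 "H (F u)"]
    by (simp add: algebra_simps scale_right_distrib scale_left_distrib)
  finally show ?case unfolding u_def by simp
qed

text \<open>If \<open>a > b\<close> is minimal with \<open>F\<^sup>a y = 0\<close>, then \<open>u = F\<^sup>a\<^sup>-\<^sup>1 y\<close> is a lowest weight vector of
  weight \<open>1 - a\<close> in the image of \<open>F\<^sup>a\<close>.  From \<open>u = F\<^sup>B w\<close> with \<open>B \<ge> a\<close> it follows that
  \<open>F\<^sup>B\<^sup>+\<^sup>1 (E w)\<close> is a nonzero multiple of \<open>u\<close>, so \<open>u\<close> lies in the image of every power of \<open>F\<close>.\<close>

lemma funpow_F_eq_0: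
  assumes nil: "\<And>v. (F ^^ N) v = 0"
    and FE: "(F ^^ Suc b) (E (F w)) = 0"
  shows "(F ^^ b) (F w) = 0"
proof (rule ccontr)
  assume nz: "(F ^^ b) (F w) \<noteq> 0"
  define y where "y = F w"
  define a where "a = (LEAST a. (F ^^ a) y = 0)"
  have a0: "(F ^^ a) y = 0" unfolding a_def by (rule LeastI[where P = "\<lambda>a. (F ^^ a) y = 0", OF nil])
  have a_least: "(F ^^ i) y \<noteq> 0" if "i < a" for i
    using not_less_Least[of i "\<lambda>a. (F ^^ a) y = 0"] that by (simp add: a_def)
  have "b < a"
  proof (rule ccontr)
    assume "\<not> b < a"
    then have "(F ^^ b) y = 0" using F.funpow_eq_0_mono[OF a0, of b] by simp
    then show False using nz by (simp add: y_def)
  qed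
  then obtain k where k: "a = Suc k" "b \<le> k" by (cases a) auto
  define u where "u = (F ^^ k) y"
  have u: "u \<noteq> 0" "F u = 0" using a_least[of k] a0 by (auto simp: u_def k)
  \<comment> \<open>As \<open>b \<le> k\<close>, the hypothesis on \<open>Suc b\<close> passes to
    \<open>Suc k\<close>. Together with \<open>F u = 0\<close>, \<open>funpow_F_E\<close> then gives
    \<open>u\<close> the weight \<open>-k\<close>.\<close>
  have "(F ^^ Suc k) (E y) = 0"
    using F.funpow_eq_0_mono[OF FE, of "Suc k"] k by (simp add: y_def del: funpow.simps)
  then have "scale (of_nat (Suc k)) (H u + scale (of_nat k) u) = 0"
    unfolding funpow_F_E using a0 by (simp add: u_def k E.zero del: of_nat_Suc)
  then have Hu: "H u = - scale (of_nat k) u"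
    by (simp del: of_nat_Suc add: eq_neg_iff_add_eq_0)
  have "\<exists>w. (F ^^ (Suc k + j)) w = u" for j
  proof (induction j)
    case 0
    show ?case by (rule exI[of _ w]) (simp add: u_def y_def funpow_swap1)
  next
    case (Suc j)
    then obtain w where w: "(F ^^ (Suc k + j)) w = u" by blast
    define l where "l = Suc k + j"
    \<comment> \<open>Since \<open>F u = 0\<close>, \<open>funpow_F_E\<close> at \<open>w\<close>
      gives \<open>-(l + 1) (H u + l u)\<close>, where \<open>H u = -k u\<close> and
      \<open>l - k = j + 1\<close>. In characteristic 0 this multiple of \<open>u\<close> is
      nonzero.\<close>
    define c :: 'k where "c = - (of_nat (Suc l) * of_nat (Suc j))"
    have wl: "(F ^^ l) w = u" "(F ^^ Suc l) w = 0" using w u by (auto simp: l_def)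
    have "c \<noteq> 0" by (simp add: c_def del: of_nat_Suc)
    have "H u + scale (of_nat l) u = scale (of_nat (Suc j)) u"
      by (simp add: Hu l_def scale_left_distrib)
    then have "(F ^^ Suc l) (E w) = scale c u"
      unfolding funpow_F_E wl by (simp add: c_def del: of_nat_Suc)
    then have "(F ^^ Suc l) (scale (inverse c) (E w)) = u"
      using \<open>c \<noteq> 0\<close> by (simp add: F.Tk.scale del: funpow.simps)
    then show ?case by (auto simp: l_def simp del: funpow.simps)
  qed
  from this[of N] obtain w where "u = (F ^^ (Suc k + N)) w" by metis
  then have "u = 0" using F.funpow_eq_0_mono[OF nil[of w], of "Suc k + N"] by simp
  with u show False by simp
qed

end

section \<open>The Killing form\<close>

text \<open>The basis selected by \<open>SOME\<close> does not depend on \<open>T\<close>, so traces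
  of different operators can be compared entry by entry over one finite \<open>B\<close>.\<close>

lemma (in vector_space) endo_trace_basis:
  assumes "finite S" "span S = UNIV"
  obtains B where "finite B" "independent B" "span B = UNIV"
    "\<forall>T. endo_trace T = (\<Sum>b\<in>B. representation B (T b) b)"
proof -
  define B where "B = (SOME B. independent B \<and> span B = UNIV)"
  have "\<exists>B. independent B \<and> span B = UNIV"
    using maximal_independent_subset[of UNIV] by (metis top.extremum_unique)
  then have B: "independent B \<and> span B = UNIV" unfolding B_def by (rule someI_ex)
  moreover have "finite B" using independent_span_bound[OF assms(1), of B] B assms(2) by simp
  ultimately show ?thesis by (intro that) (auto simp: endo_trace_def B_def Let_def)
qed

lemma (in vector_space) endo_trace_add:
  assumes "finite S" "span S = UNIV"
  shows "endo_trace (\<lambda>v. T v + U v) = endo_trace T + endo_trace U"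
proof -
  obtain B where "finite B" "independent B" "span B = UNIV"
    "\<forall>T. endo_trace T = (\<Sum>b\<in>B. representation B (T b) b)"
    using endo_trace_basis[OF assms] by blast
  then show ?thesis by (simp add: representation_add sum.distrib)
qed

lemma (in vector_space) endo_trace_scale:
  assumes "finite S" "span S = UNIV"
  shows "endo_trace (\<lambda>v. scale c (T v)) = c * endo_trace T"
proof -
  obtain B where "finite B" "independent B" "span B = UNIV"
    "\<forall>T. endo_trace T = (\<Sum>b\<in>B. representation B (T b) b)"
    using endo_trace_basis[OF assms] by blast
  then show ?thesis by (simp add: representation_scale sum_distrib_left)
qed

lemma (in vector_space) endo_trace_commute:
  assumes S: "finite S" "span S = UNIV"
    and T: "module_hom scale scale T" and U: "module_hom scale scale U"
  shows "endo_trace (\<lambda>v. T (U v)) = endo_trace (\<lambda>v. U (T v))"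
proof -
  interpret T: module_hom scale scale T by (rule T)
  interpret U: module_hom scale scale U by (rule U)
  obtain B where B: "finite B" "independent B" "span B = UNIV"
    "\<forall>T. endo_trace T = (\<Sum>b\<in>B. representation B (T b) b)"
    using endo_trace_basis[OF S] by blast
  have expand: "v = (\<Sum>b\<in>B. scale (representation B v b) b)" for v
    using sum_representation_eq[OF B(2), of v B] B by simp
  have *: "representation B (X (Y b)) b = (\<Sum>c\<in>B. representation B (Y b) c * representation B (X c) b)"
    if "module_hom scale scale X" for X Y b
  proof -
    interpret X: module_hom scale scale X by (rule that)
    have "X (Y b) = (\<Sum>c\<in>B. scale (representation B (Y b) c) (X c))"
      by (subst expand[of "Y b"]) (simp add: X.sum X.scale)
    then show ?thesis using B by (simp add: representation_sum representation_scale)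
  qed
  show ?thesis
    unfolding B(4)[rule_format] *[OF T, of U] *[OF U, of T] by (subst sum.swap) (simp add: mult.commute)
qed

locale finite_dim_lie_algebra = lie_algebra +
  assumes finite_dim: "\<exists>B. finite B \<and> span B = UNIV"
begin

lemma ad_linear: "module_hom scale scale (br x)"
  by unfold_locales (auto simp: br_add_right br_scale_right)

sublocale ad: module_hom scale scale "br x" for x by (rule ad_linear)

lemma ad_left_linear: "module_hom scale scale (\<lambda>x. br x y)"
  by unfold_locales (auto simp: br_add_left br_scale_left)

sublocale ad_left: module_hom scale scale "\<lambda>x. br x y" for y by (rule ad_left_linear)

lemma br_commute: "br x y = - br y x"
  using br_self[of "x + y"] unfolding br_add_left br_add_right
  by (simp add: br_self eq_neg_iff_add_eq_0 add.commute)

lemma br_br: "br (br x y) z = br x (br y z) - br y (br x z)"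
proof -
  have "br y (br z x) = - br y (br x z)" using br_commute[of z x] ad.neg by simp
  then have "- (br x (br y z) + - br y (br x z)) = br z (br x y)"
    using jacobi[of x y z] by (intro minus_unique) simp
  then have "br z (br x y) = br y (br x z) - br x (br y z)" by simp
  then show ?thesis using br_commute[of "br x y" z] by simp
qed

lemma killing_add_left: "killing (x + y) z = killing x z + killing y z"
  using finite_dim unfolding killing_def br_add_left by (auto intro: endo_trace_add)

lemma killing_scale_left: "killing (scale c x) y = c * killing x y"
  using finite_dim unfolding killing_def br_scale_left by (auto intro: endo_trace_scale)

lemma killing_commute: "killing x y = killing y x"
  using finite_dim unfolding killing_def by (auto intro: endo_trace_commute ad_linear)

lemma killing_add_right: "killing z (x + y) = killing z x + killing z y"
  by (simp add: killing_commute[of z] killing_add_left)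

lemma killing_scale_right: "killing y (scale c x) = c * killing y x"
  by (simp add: killing_commute[of y] killing_scale_left)

sublocale killing_left: module_hom scale "(*)" "\<lambda>x. killing x y" for y
  by unfold_locales (auto simp: killing_add_left killing_scale_left algebra_simps)

sublocale killing_right: module_hom scale "(*)" "killing x" for x
  by unfold_locales (auto simp: killing_add_right killing_scale_right algebra_simps)

text \<open>Invariance of the Killing form: write \<open>ad [a, b]\<close> and
  \<open>ad [b, c]\<close> as commutators; the traces match after one cyclic shift that moves
  \<open>ad b\<close> to the end.\<close>

lemma killing_br: "killing (br a b) c = killing a (br b c)"
proof -
  obtain S where S: "finite S" "span S = UNIV" using finite_dim by blast
  have diff: "endo_trace (\<lambda>v. T v - U v) = endo_trace T - endo_trace U" for T U
    using endo_trace_add[OF S, of T "\<lambda>v. scale (-1) (U v)"] endo_trace_scale[OF S, of "-1" U] by simp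
  have lin: "module_hom scale scale (\<lambda>v. br x (br y v))" for x y
    by unfold_locales (auto simp: br_add_right br_scale_right)
  have "killing (br a b) c = endo_trace (\<lambda>v. br a (br b (br c v))) - endo_trace (\<lambda>v. br b (br a (br c v)))"
    unfolding killing_def br_br diff ..
  also have "endo_trace (\<lambda>v. br b (br a (br c v))) = endo_trace (\<lambda>v. br a (br c (br b v)))"
    by (rule endo_trace_commute[OF S ad_linear lin])
  also have "endo_trace (\<lambda>v. br a (br b (br c v))) - \<dots> = killing a (br b c)"
    unfolding killing_def br_br ad.diff diff ..
  finally show ?thesis .
qed

end

section \<open>The Slodowy slice\<close>

text \<open>\<open>I\<close> and \<open>J\<close> stand for \<open>1..n\<close> and
  \<open>1..m\<close>, so the constraints are indexed by \<open>I - J\<close>. Nondegeneracy of the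
  Killing form is drawn from the dual family, in \<open>killing_nondegenerate\<close>.\<close>

locale slodowy_coordinates = finite_dim_lie_algebra scale br
  for scale :: "'k::field_char_0 \<Rightarrow> 'g::ab_group_add \<Rightarrow> 'g" and br :: "'g \<Rightarrow> 'g \<Rightarrow> 'g" +
  fixes e h f :: 'g and \<xi> \<eta> :: "'i \<Rightarrow> 'g" and I J :: "'i set"
  assumes sl2: "sl2_triple e h f"
    and finite_I: "finite I" and J_subset: "J \<subseteq> I"
    and basis: "basis_family UNIV I \<xi>"
    and basis_ker: "basis_family (ad_kernel f) J \<xi>"
    and dual: "dual_family I \<xi> \<eta>"
begin

abbreviation (input) A :: "'i set" where "A \<equiv> I - J"

sublocale sl2: sl2_representation scale "br e" "br h" "br f"
proof (intro sl2_representation.intro sl2_representation_axioms.intro vector_space_axioms ad_linear)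
  have he: "br h f = scale (- 2) f" and ef: "br e f = h"
    using sl2 unfolding sl2_triple_def by auto
  show "br h (br f v) = br f (br h v) - scale 2 (br f v)" for v
    using br_br[of h f v] unfolding he br_scale_left by (simp add: algebra_simps)
  show "br e (br f v) = br f (br e v) + br h v" for v
    using br_br[of e f v] unfolding ef by (simp add: algebra_simps)
qed

lemma ad_f_nilpotent: "\<exists>N. \<forall>v. (br f ^^ N) v = 0"
proof -
  obtain B where B: "finite B" "span B = UNIV" using finite_dim by blast
  show ?thesis
    by (rule sl2.F.nilpotent_if_commutator[OF _ B ad_linear[of h], of "-2"]) (simp_all add: sl2.HF)
qed

section \<open>Dual bases and orthogonality\<close>

lemma killing_dual: "i \<in> I \<Longrightarrow> j \<in> I \<Longrightarrow> killing (\<xi> i) (\<eta> j) = (if i = j then 1 else 0)"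
  using dual unfolding dual_family_def by blast

lemma span_family:
  assumes "inj_on \<xi> K" "finite K" "v \<in> span (\<xi> ` K)"
  obtains c where "v = (\<Sum>i\<in>K. scale (c i) (\<xi> i))"
proof -
  obtain u where "v = (\<Sum>w\<in>\<xi> ` K. scale (u w) w)"
    using assms by (auto simp: span_finite)
  then show ?thesis using that[of "\<lambda>i. u (\<xi> i)"] by (simp add: sum.reindex[OF assms(1)] o_def)
qed

lemma inj_on_\<xi>: "inj_on \<xi> I" and indep_\<xi>: "independent (\<xi> ` I)" and span_\<xi>: "span (\<xi> ` I) = UNIV"
  using basis by (auto simp: basis_family_def)

lemma span_\<xi>_J: "span (\<xi> ` J) = ad_kernel f"
  using basis_ker by (auto simp: basis_family_def)

lemma killing_sum_\<eta>:
  assumes "K \<subseteq> I" "j \<in> I"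
  shows "killing (\<Sum>i\<in>K. scale (c i) (\<xi> i)) (\<eta> j) = (if j \<in> K then c j else 0)"
proof -
  have "killing (\<Sum>i\<in>K. scale (c i) (\<xi> i)) (\<eta> j) = (\<Sum>i\<in>K. if i = j then c i else 0)"
    unfolding killing_left.sum killing_left.scale
    using assms by (intro sum.cong refl) (auto simp: killing_dual)
  also have "\<dots> = (if j \<in> K then c j else 0)"
    using finite_subset[OF assms(1) finite_I] by simp
  finally show ?thesis .
qed

lemma expand_\<xi>: "v = (\<Sum>i\<in>I. scale (killing v (\<eta> i)) (\<xi> i))"
proof -
  obtain c where v: "v = (\<Sum>i\<in>I. scale (c i) (\<xi> i))"
    using span_family[OF inj_on_\<xi> finite_I, of v] span_\<xi> by auto
  have "killing v (\<eta> i) = c i" if "i \<in> I" for i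
    unfolding v using that by (simp add: killing_sum_\<eta>)
  then show ?thesis by (subst v) simp
qed

lemma killing_ad_kernel:
  assumes "v \<in> ad_kernel f" "\<alpha> \<in> A"
  shows "killing v (\<eta> \<alpha>) = 0"
proof -
  obtain c where v: "v = (\<Sum>i\<in>J. scale (c i) (\<xi> i))"
    using span_family[of J v] assms(1) inj_on_subset[OF inj_on_\<xi> J_subset]
      finite_subset[OF J_subset finite_I] span_\<xi>_J by auto
  show ?thesis unfolding v using J_subset assms(2) by (simp add: killing_sum_\<eta>)
qed

lemma \<xi>_in_ad_kernel: "i \<in> J \<Longrightarrow> br f (\<xi> i) = 0"
  using span_base[of "\<xi> i" "\<xi> ` J"] span_\<xi>_J by (auto simp: ad_kernel_def)

lemma expand_ad_kernel:
  assumes "v \<in> ad_kernel f"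
  shows "v = (\<Sum>i\<in>J. scale (killing v (\<eta> i)) (\<xi> i))"
proof -
  have "(\<Sum>i\<in>I. scale (killing v (\<eta> i)) (\<xi> i)) = (\<Sum>i\<in>J. scale (killing v (\<eta> i)) (\<xi> i))"
    by (rule sum.mono_neutral_right) (use killing_ad_kernel[OF assms] finite_I J_subset in auto)
  then show ?thesis using expand_\<xi>[of v] by simp
qed

text \<open>Such a \<open>v\<close> is orthogonal to everything, in particular to each
  \<open>\<eta> i\<close>; but the numbers \<open>killing v (\<eta> i)\<close> are the coordinates
  of \<open>v\<close> in the basis \<open>\<xi>\<close>.\<close>

lemma killing_nondegenerate:
  assumes "\<And>i. i \<in> I \<Longrightarrow> killing (\<xi> i) v = 0"
  shows "v = 0"
proof -
  have "killing v y = 0" for y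
  proof -
    have "killing y v = (\<Sum>i\<in>I. killing y (\<eta> i) * killing (\<xi> i) v)"
      by (subst expand_\<xi>[of y]) (simp only: killing_left.sum killing_left.scale)
    then show ?thesis by (simp add: assms killing_commute[of v])
  qed
  then show ?thesis using expand_\<xi>[of v] by simp
qed

lemma expand_\<eta>: "v = (\<Sum>i\<in>I. scale (killing (\<xi> i) v) (\<eta> i))"
proof -
  have "v - (\<Sum>i\<in>I. scale (killing (\<xi> i) v) (\<eta> i)) = 0"
  proof (rule killing_nondegenerate)
    fix j assume j: "j \<in> I"
    have "killing (\<xi> j) (\<Sum>i\<in>I. scale (killing (\<xi> i) v) (\<eta> i))
        = (\<Sum>i\<in>I. if i = j then killing (\<xi> i) v else 0)"
      unfolding killing_right.sum killing_right.scale
      using j by (intro sum.cong refl) (auto simp: killing_dual)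
    then show "killing (\<xi> j) (v - (\<Sum>i\<in>I. scale (killing (\<xi> i) v) (\<eta> i))) = 0"
      using j finite_I by (simp add: killing_right.diff)
  qed
  then show ?thesis by simp
qed

text \<open>By invariance the image of \<open>ad f\<close> is orthogonal to the kernel of
  \<open>ad f\<close>, so the coefficients with index in \<open>J\<close> vanish.\<close>

lemma expand_\<eta>_range:
  assumes "v \<in> range (br f)"
  shows "v = (\<Sum>\<alpha>\<in>A. scale (killing (\<xi> \<alpha>) v) (\<eta> \<alpha>))"
proof -
  obtain w where w: "v = br f w" using assms by auto
  have "killing (\<xi> i) v = 0" if "i \<in> J" for i
  proof -
    have "br (\<xi> i) f = 0" using br_commute[of "\<xi> i" f] \<xi>_in_ad_kernel[OF that] by simp
    then show ?thesis unfolding w killing_br[symmetric] by simp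
  qed
  then have "(\<Sum>i\<in>I. scale (killing (\<xi> i) v) (\<eta> i)) = (\<Sum>\<alpha>\<in>A. scale (killing (\<xi> \<alpha>) v) (\<eta> \<alpha>))"
    by (intro sum.mono_neutral_right) (use finite_I in auto)
  then show ?thesis using expand_\<eta>[of v] by simp
qed

section \<open>The equation at the base point \<open>z = e\<close>\<close>

text \<open>\<open>ad f ad e\<close> maps the image of \<open>ad f\<close> into itself and is
  injective there by the result on \<open>sl2\<close> representations. Finite dimension makes it
  onto, and \<open>[f, x]\<close> lies in that image.\<close>

lemma range_ad_f_lift: "\<exists>u\<in>range (br f). br f (br e u) = br f x"
proof -
  interpret fd: finite_dimensional_vector_space scale "\<xi> ` I"
    by unfold_locales (use finite_I indep_\<xi> span_\<xi> in auto)
  interpret fd: finite_dimensional_vector_space_pair_1 scale "\<xi> ` I" scale ..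
  obtain N where N: "\<And>v. (br f ^^ N) v = 0" using ad_f_nilpotent by blast
  let ?R = "range (br f)" and ?T = "\<lambda>v. br f (br e v)"
  have T: "module_hom scale scale ?T"
    by unfold_locales (auto simp: ad.add ad.scale)
  interpret T: module_hom scale scale ?T by (rule T)
  have R: "subspace ?R" by (rule ad.subspace_image[OF subspace_UNIV])
  have span_R: "span ?R = ?R" using R by (rule span_eq_iff[THEN iffD2])
  have "inj_on ?T ?R"
    \<comment> \<open>With \<open>b = 0\<close>, \<open>funpow_F_eq_0\<close> says that
      \<open>[f, [e, [f, w]]] = 0\<close> implies \<open>[f, w] = 0\<close>.\<close>
    unfolding T.inj_on_iff_eq_0[OF R] using sl2.funpow_F_eq_0[OF N, of 0] by auto
  then have "dim (?T ` ?R) = dim ?R"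
    using fd.dim_image_eq[of ?T ?R] T unfolding span_R linear_iff_module_hom by simp
  then have "?T ` ?R = ?R"
    by (intro fd.subspace_dim_equal T.subspace_image R) auto
  moreover have "br f x \<in> ?R" by simp
  ultimately have "br f x \<in> ?T ` ?R" by (rule equalityD2[THEN subsetD])
  then obtain u where "u \<in> ?R" "br f x = ?T u" by (rule imageE)
  then show ?thesis by (intro bexI[of _ u]) simp_all
qed

definition lift :: "'i \<Rightarrow> 'g" where
  "lift \<gamma> = (SOME u. u \<in> range (br f) \<and> br f (br e u) = br f (\<xi> \<gamma>))"

lemma lift: "lift \<gamma> \<in> range (br f)" "br f (br e (lift \<gamma>)) = br f (\<xi> \<gamma>)"
  using someI_ex[OF range_ad_f_lift[of "\<xi> \<gamma>", unfolded Bex_def]] unfolding lift_def by auto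

text \<open>A linear right inverse: it sends \<open>y\<close> to a solution \<open>u\<close> of
  \<open>[f, [e, u]] = [f, y]\<close>. Indices in \<open>J\<close> are left out because
  \<open>ad f\<close> kills those \<open>\<xi> i\<close>. Defining it on coordinates gives linearity
  at once and keeps its dependence on \<open>y\<close> explicit.\<close>

definition lift_map :: "'g \<Rightarrow> 'g" where
  "lift_map y = (\<Sum>\<gamma>\<in>A. scale (killing y (\<eta> \<gamma>)) (lift \<gamma>))"

lemma lift_map_linear: "module_hom scale scale lift_map"
  by unfold_locales
    (simp_all add: lift_map_def killing_left.add killing_left.scale scale_left_distrib
      sum.distrib scale_sum_right)

sublocale lift_map: module_hom scale scale lift_map by (rule lift_map_linear)

lemma lift_map_range: "lift_map y \<in> range (br f)"
  unfolding lift_map_def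
  by (intro subspace_sum subspace_scale ad.subspace_image[OF subspace_UNIV] lift)

lemma br_f_e_lift_map: "br f (br e (lift_map y)) = br f y"
proof -
  have "br f y = (\<Sum>i\<in>I. scale (killing y (\<eta> i)) (br f (\<xi> i)))"
    by (subst expand_\<xi>[of y]) (simp only: ad.sum ad.scale)
  also have "\<dots> = (\<Sum>i\<in>A. scale (killing y (\<eta> i)) (br f (\<xi> i)))"
    by (rule sum.mono_neutral_right) (use finite_I \<xi>_in_ad_kernel in auto)
  also have "\<dots> = br f (br e (lift_map y))"
    by (simp add: lift_map_def ad.sum ad.scale lift)
  finally show ?thesis ..
qed

section \<open>Perturbation from \<open>e\<close> to \<open>e + x\<close> and its
  termination\<close>

lemma funpow_ad_f_br:
  assumes "x \<in> ad_kernel f"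
  shows "(br f ^^ k) (br x v) = br x ((br f ^^ k) v)"
proof (induction k)
  case (Suc k)
  have "br f (br x w) = br x (br f w)" for w
    using br_br[of f x w] assms by (simp add: ad_kernel_def)
  then show ?case using Suc by simp
qed simp

text \<open>This is the contraction behind the iteration. Since \<open>ad f\<close> commutes with
  \<open>ad x\<close>, applying \<open>(ad f)^(j+1) ad e\<close> to the lift yields
  \<open>[x, (ad f)^(j+1) d] = 0\<close>. As the lift lies in the image of \<open>ad f\<close>,
  \<open>funpow_F_eq_0\<close> with \<open>b = j\<close> removes \<open>ad e\<close> and one power
  of \<open>ad f\<close>.\<close>

lemma funpow_lift_map_br:
  assumes N: "\<And>v. (br f ^^ N) v = 0" and x: "x \<in> ad_kernel f" and d: "(br f ^^ Suc j) d = 0"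
  shows "(br f ^^ j) (lift_map (br x d)) = 0"
proof -
  obtain w where w: "lift_map (br x d) = br f w" using lift_map_range by blast
  have "(br f ^^ Suc j) (br e (br f w)) = (br f ^^ j) (br f (br e (lift_map (br x d))))"
    unfolding w by (simp add: funpow_swap1)
  also have "\<dots> = br x ((br f ^^ Suc j) d)"
    unfolding br_f_e_lift_map funpow_ad_f_br[OF x, symmetric] by (simp add: funpow_swap1)
  finally show ?thesis unfolding w d using sl2.funpow_F_eq_0[OF N] by simp
qed

text \<open>Picard iteration for the equation \<open>[f, [z, u]] = [f, \<xi> \<beta>]\<close> with \<open>u\<close> in the image of \<open>ad f\<close>.\<close>

primrec approx :: "nat \<Rightarrow> 'i \<Rightarrow> 'g \<Rightarrow> 'g" where
  "approx 0 \<beta> z = lift \<beta>"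
| "approx (Suc k) \<beta> z = lift \<beta> - lift_map (br (z - e) (approx k \<beta> z))"

lemma approx_range: "approx k \<beta> z \<in> range (br f)"
  by (cases k) (auto simp only: approx.simps
      intro!: subspace_diff ad.subspace_image[OF subspace_UNIV] lift lift_map_range)

text \<open>Each difference of consecutive approximations is minus the lift of
  \<open>[z - e, d]\<close> for the previous difference \<open>d\<close>. The first is killed by
  \<open>(ad f)^N\<close>, and every step lowers the exponent by one.\<close>

lemma approx_diff:
  assumes N: "\<And>v. (br f ^^ N) v = 0" and x: "z - e \<in> ad_kernel f" and "k \<le> N"
  shows "(br f ^^ (N - k)) (approx (Suc k) \<beta> z - approx k \<beta> z) = 0"
  using \<open>k \<le> N\<close>
proof (induction k)
  case 0
  show ?case by (simp add: N)
next
  case (Suc k)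
  define d where "d = approx (Suc k) \<beta> z - approx k \<beta> z"
  have "approx (Suc (Suc k)) \<beta> z - approx (Suc k) \<beta> z = - lift_map (br (z - e) d)"
    unfolding d_def ad.diff lift_map.diff by simp
  moreover have "(br f ^^ Suc (N - Suc k)) d = 0"
    using Suc by (simp add: d_def Suc_diff_Suc del: funpow.simps approx.simps)
  ultimately show ?case
    using funpow_lift_map_br[OF N x] by (simp add: sl2.F.Tk.neg del: approx.simps)
qed

lemma br_f_approx:
  assumes N: "\<And>v. (br f ^^ N) v = 0" and x: "z - e \<in> ad_kernel f"
  shows "br f (br z (approx N \<beta> z)) = br f (\<xi> \<beta>)"
proof -
  define u where "u = approx N \<beta> z"
  \<comment> \<open>At \<open>k = N\<close> the exponent \<open>N - k\<close> is 0, so the step from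
    \<open>N\<close> to \<open>N + 1\<close> changes nothing and \<open>u\<close> is a fixed
    point.\<close>
  have u: "u = lift \<beta> - lift_map (br (z - e) u)"
    using approx_diff[OF N x, of N \<beta>] by (simp add: u_def)
  have "br f (br e u) = br f (\<xi> \<beta>) - br f (br (z - e) u)"
    by (subst u) (simp add: ad.diff lift br_f_e_lift_map)
  then show ?thesis
    unfolding u_def[symmetric] by (simp add: ad_left.diff ad.diff)
qed

section \<open>The inverse of the minor\<close>

text \<open>Let \<open>u\<close> be the approximation. It lies in the image of \<open>ad f\<close>,
  so the sum reassembles it and becomes the pairing of \<open>[z, u]\<close> with
  \<open>\<eta> \<alpha>\<close>. Now \<open>[z, u]\<close> differs from
  \<open>\<xi> \<beta>\<close> by an element of the kernel of \<open>ad f\<close>, which is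
  orthogonal to \<open>\<eta> \<alpha>\<close>.\<close>

lemma lie_poisson_approx:
  assumes N: "\<And>v. (br f ^^ N) v = 0" and x: "z - e \<in> ad_kernel f"
    and ab: "\<alpha> \<in> A" "\<beta> \<in> A"
  shows "(\<Sum>\<gamma>\<in>A. lie_poisson \<eta> \<alpha> \<gamma> z * killing (\<xi> \<gamma>) (approx N \<beta> z)) = (if \<alpha> = \<beta> then 1 else 0)"
proof -
  define u where "u = approx N \<beta> z"
  have "(\<Sum>\<gamma>\<in>A. lie_poisson \<eta> \<alpha> \<gamma> z * killing (\<xi> \<gamma>) u)
      = - killing z (br (\<eta> \<alpha>) (\<Sum>\<gamma>\<in>A. scale (killing (\<xi> \<gamma>) u) (\<eta> \<gamma>)))"
    by (simp add: lie_poisson_def ad.sum ad.scale killing_right.sum killing_right.scale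
        sum_negf mult.commute)
  also have "(\<Sum>\<gamma>\<in>A. scale (killing (\<xi> \<gamma>) u) (\<eta> \<gamma>)) = u"
    using expand_\<eta>_range[of u] approx_range by (simp add: u_def)
  also have "- killing z (br (\<eta> \<alpha>) u) = killing (br z u) (\<eta> \<alpha>)"
    using br_commute[of "\<eta> \<alpha>" u] by (simp add: killing_br killing_right.neg)
  also have "\<dots> = killing (\<xi> \<beta>) (\<eta> \<alpha>)"
  proof -
    have "br z u - \<xi> \<beta> \<in> ad_kernel f"
      using br_f_approx[OF N x] by (simp add: ad_kernel_def ad.diff u_def)
    then show ?thesis using killing_ad_kernel[of "br z u - \<xi> \<beta>" \<alpha>] ab(1) by (simp add: killing_left.diff)
  qed
  finally show ?thesis using ab by (auto simp: killing_dual u_def)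
qed

lemma slodowy_slice_iff: "z \<in> slodowy_slice e f \<longleftrightarrow> z - e \<in> ad_kernel f"
  unfolding slodowy_slice_def by (force intro: exI[of _ "z - e"])

lemma matrix_inverse_on_approx:
  assumes N: "\<And>v. (br f ^^ N) v = 0" and z: "z \<in> slodowy_slice e f"
  shows "matrix_inverse_on A (\<lambda>\<alpha> \<beta>. lie_poisson \<eta> \<alpha> \<beta> z)
    (\<lambda>\<alpha> \<beta>. killing (\<xi> \<alpha>) (approx N \<beta> z))"
proof (rule matrix_inverse_on_skew)
  show "lie_poisson \<eta> \<beta> \<alpha> z = - lie_poisson \<eta> \<alpha> \<beta> z" for \<alpha> \<beta>
    using br_commute[of "\<eta> \<alpha>" "\<eta> \<beta>"] by (simp add: lie_poisson_def killing_right.neg)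
  show "(\<Sum>\<gamma>\<in>A. lie_poisson \<eta> \<alpha> \<gamma> z * killing (\<xi> \<gamma>) (approx N \<beta> z)) = (if \<alpha> = \<beta> then 1 else 0)"
    if "\<alpha> \<in> A" "\<beta> \<in> A" for \<alpha> \<beta>
    using lie_poisson_approx[OF N _ that] z by (simp add: slodowy_slice_iff)
qed (use finite_I in simp)

lemma ex_minor_inverse:
  assumes "z \<in> slodowy_slice e f"
  shows "\<exists>N. matrix_inverse_on A (\<lambda>\<alpha> \<beta>. lie_poisson \<eta> \<alpha> \<beta> z) N"
  using ad_f_nilpotent matrix_inverse_on_approx assms by blast

section \<open>Polynomial dependence on the slice\<close>

abbreviation polynomial :: "('g \<Rightarrow> 'k) \<Rightarrow> bool" where
  "polynomial \<equiv> polynomial_function_on (slodowy_slice e f) J (coord e \<eta>)"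

lemma killing_slice:
  assumes "z \<in> slodowy_slice e f"
  shows "killing (z - e) v = (\<Sum>i\<in>J. coord e \<eta> i z * killing (\<xi> i) v)"
proof -
  have "z - e \<in> ad_kernel f" using assms by (simp add: slodowy_slice_iff)
  then have "killing (z - e) v = killing (\<Sum>i\<in>J. scale (killing (z - e) (\<eta> i)) (\<xi> i)) v"
    using expand_ad_kernel by simp
  then show ?thesis by (simp only: killing_left.sum killing_left.scale coord_def)
qed

lemma polynomial_coord: "i \<in> J \<Longrightarrow> polynomial (coord e \<eta> i)"
  using finite_subset[OF J_subset finite_I] by (rule polynomial_function_on_coord)

lemma polynomial_lie_poisson: "polynomial (lie_poisson \<eta> i j)"
proof (rule polynomial_function_on_cong)
  show "lie_poisson \<eta> i j z = - killing e (br (\<eta> i) (\<eta> j))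
      - (\<Sum>l\<in>J. coord e \<eta> l z * killing (\<xi> l) (br (\<eta> i) (\<eta> j)))" if "z \<in> slodowy_slice e f" for z
    by (simp add: killing_slice[OF that, symmetric] lie_poisson_def killing_left.diff)
qed (intro polynomial_function_on_intros polynomial_coord; assumption)+

text \<open>One recursion step is affine in the previous approximation, with coefficients linear in
  the coordinates. The induction needs every \<open>y\<close>, because the step pairs the previous
  approximation with the vectors \<open>[\<xi> i, \<eta> \<gamma>]\<close>.\<close>

lemma polynomial_killing_approx: "polynomial (\<lambda>z. killing y (approx k \<beta> z))"
proof (induction k arbitrary: y)
  case 0
  show ?case by (simp add: polynomial_function_on_const)
next
  case (Suc k)
  show ?case
  proof (rule polynomial_function_on_cong)
    fix z assume z: "z \<in> slodowy_slice e f"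
    \<comment> \<open>Invariance moves \<open>u\<close> out of the bracket, so that
      \<open>z - e\<close> can be expanded in the coordinates; the sign comes from exchanging
      \<open>u\<close> and \<open>\<eta> \<gamma>\<close>.\<close>
    have "killing (br (z - e) u) (\<eta> \<gamma>)
        = (\<Sum>i\<in>J. coord e \<eta> i z * - killing (br (\<xi> i) (\<eta> \<gamma>)) u)" for u \<gamma>
      unfolding killing_br killing_slice[OF z]
      by (subst br_commute) (simp add: killing_right.neg)
    then show "killing y (approx (Suc k) \<beta> z) = killing y (lift \<beta>)
        - (\<Sum>\<gamma>\<in>A. (\<Sum>i\<in>J. coord e \<eta> i z * - killing (br (\<xi> i) (\<eta> \<gamma>)) (approx k \<beta> z))
            * killing y (lift \<gamma>))"
      by (simp only: approx.simps killing_right.diff lift_map_def killing_right.sum killing_right.scale)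
  qed (intro polynomial_function_on_intros polynomial_coord Suc; assumption)+
qed

lemma polynomial_dirac_bracket: "polynomial (dirac_bracket \<eta> A i j)"
proof -
  \<comment> \<open>\<open>N\<close> is independent of \<open>z\<close>, so one polynomial formula
    holds on the whole slice.\<close>
  obtain N where N: "\<And>v. (br f ^^ N) v = 0" using ad_f_nilpotent by blast
  show ?thesis
  proof (rule polynomial_function_on_cong)
    fix z assume z: "z \<in> slodowy_slice e f"
    have "matrix_inverse_on A (\<lambda>\<alpha> \<beta>. lie_poisson \<eta> \<alpha> \<beta> z) (minor_inverse \<eta> A z)"
      unfolding minor_inverse_def by (rule someI_ex[OF ex_minor_inverse[OF z]])
    then have "minor_inverse \<eta> A z \<beta> \<alpha> = killing (\<xi> \<beta>) (approx N \<alpha> z)" if "\<alpha> \<in> A" "\<beta> \<in> A" for \<alpha> \<beta>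
      using matrix_inverse_on_unique[OF _ _ matrix_inverse_on_approx[OF N z]] that finite_I by simp
    then show "dirac_bracket \<eta> A i j z = lie_poisson \<eta> i j z - (\<Sum>\<alpha>\<in>A. \<Sum>\<beta>\<in>A.
        lie_poisson \<eta> i \<beta> z * killing (\<xi> \<beta>) (approx N \<alpha> z) * lie_poisson \<eta> \<alpha> j z)"
      unfolding dirac_bracket_def by simp
  qed (intro polynomial_function_on_intros polynomial_lie_poisson polynomial_killing_approx)
qed

end

theorem mainTheorem5:
  fixes scale :: "complex \<Rightarrow> 'g::ab_group_add \<Rightarrow> 'g"
    and br :: "'g \<Rightarrow> 'g \<Rightarrow> 'g"
    and e h f :: 'g
    and \<xi> \<eta> :: "nat \<Rightarrow> 'g"
    and m n :: nat
  assumes "simple_lie_algebra scale br"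
    and "lie_algebra.sl2_triple scale br e h f"
    and "m \<le> n"
    and "vector_space.basis_family scale UNIV {1..n} \<xi>"
    and "vector_space.basis_family scale (lie_algebra.ad_kernel br f) {1..m} \<xi>"
    and "lie_algebra.dual_family scale br {1..n} \<xi> \<eta>"
  shows "(\<forall>z\<in>lie_algebra.slodowy_slice br e f.
            \<exists>N. matrix_inverse_on {m+1..n}
                  (\<lambda>\<alpha> \<beta>. lie_algebra.lie_poisson scale br \<eta> \<alpha> \<beta> z) N)
       \<and> (\<forall>i\<in>{1..m}. \<forall>j\<in>{1..m}.
            polynomial_function_on (lie_algebra.slodowy_slice br e f) {1..m}
              (lie_algebra.coord scale br e \<eta>)
              (lie_algebra.dirac_bracket scale br \<eta> {m+1..n} i j))"
proof -
  interpret simple_lie_algebra scale br by fact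
  interpret slodowy_coordinates scale br e h f \<xi> \<eta> "{1..n}" "{1..m}"
    by unfold_locales (use assms finite_dim in auto)
  have "{1..n} - {1..m} = {m+1..n}" using \<open>m \<le> n\<close> by auto
  then show ?thesis using ex_minor_inverse polynomial_dirac_bracket by simp
qed

end
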